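(* Let $\{X_k, k\in\mathbb{N}\}$ be a standardized Gaussian process. Suppose there exists a function $r:[0,\infty)\to\mathbb{R}$ with $\lim_{x\to\infty}r(x)=0$ such that $$|\mathbf{E}X_iX_j|\le r(|i-j|)\qquad\text{for all } i,j\in\mathbb{N}.$$ Then $$\sup_{t\in\mathbb{R}}\left|\widehat{F}_n(t)-\mathbf{E}\widehat{F}_n(t)\right|\xrightarrow{P}0\quad\text{as } n\to\infty,$$ where $\xrightarrow{P}$ denotes convergence in probability.
   Context: Here $\mathbb{N}=\{1,2,3,\dots\}$. A stochastic process $\{X_k,k\in\mathbb{N}\}$ of real random variables on a common probability space is a Gaussian process if for every finite set of indices $\{k_1,\dots,k_m\}$, $m\ge 1$, the joint distribution of $(X_{k_1},\dots,X_{k_m})$ is multivariate Gaussian (possibly degenerate). It is a standardized Gaussian process if in addition $X_k\sim\mathcal{N}(0,1)$ for every $k\in\mathbb{N}$. Let $\Phi$ be the cumulative distribution function of the standard Gaussian $\mathcal{N}(0,1)$. The empirical distribution is $$\widehat{F}_n(t)=\frac1n\sum_{i=1}^n\mathbf{1}(\Phi(X_i)\le t),\qquad t\in\mathbb{R},$$ where $\mathbf{1}(A)$ is the indicator of the event $A$. *)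

theory Defs
  imports "HOL-Probability.Probability"
begin

text \<open>
  A law on \<open>\<real>\<^sup>J\<close> (with \<open>J\<close> finite) is multivariate Gaussian if it is the law of \<open>m + A Z\<close>, where
  the coordinates of \<open>Z\<close> are independent standard Gaussians. Its mean is \<open>m\<close> and its covariance
  matrix is \<open>A A\<^sup>T\<close>; the law is degenerate when \<open>A\<close> is singular, which is permitted. A square \<open>A\<close>
  is enough, as every covariance matrix has a square root.
\<close>

definition multivariate_gaussian :: "'i set \<Rightarrow> ('i \<Rightarrow> real) measure \<Rightarrow> bool" where
  "multivariate_gaussian J N \<longleftrightarrow>
     (\<exists>(m :: 'i \<Rightarrow> real) (A :: 'i \<Rightarrow> 'i \<Rightarrow> real).
        N = distr (PiM J (\<lambda>_. std_normal_distribution)) (PiM J (\<lambda>_. borel))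
              (\<lambda>z. \<lambda>i\<in>J. m i + (\<Sum>j\<in>J. A i j * z j)))"

definition gaussian_process :: "'a measure \<Rightarrow> 'i set \<Rightarrow> ('i \<Rightarrow> 'a \<Rightarrow> real) \<Rightarrow> bool" where
  "gaussian_process M I X \<longleftrightarrow>
     (\<forall>i\<in>I. X i \<in> borel_measurable M) \<and>
     (\<forall>J. J \<subseteq> I \<longrightarrow> finite J \<longrightarrow> J \<noteq> {} \<longrightarrow>
        multivariate_gaussian J (distr M (PiM J (\<lambda>_. borel)) (\<lambda>\<omega>. \<lambda>i\<in>J. X i \<omega>)))"

definition standardized_gaussian_process ::
    "'a measure \<Rightarrow> 'i set \<Rightarrow> ('i \<Rightarrow> 'a \<Rightarrow> real) \<Rightarrow> bool" where
  "standardized_gaussian_process M I X \<longleftrightarrow>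
     gaussian_process M I X \<and>
     (\<forall>i\<in>I. distributed M lborel (X i) std_normal_density)"

definition \<Phi> :: "real \<Rightarrow> real" where
  "\<Phi> = cdf std_normal_distribution"

text \<open>Only \<open>X 1, \<dots>, X n\<close> enter; the value of \<open>X 0\<close> is never used.\<close>

definition empirical_distribution ::
    "(nat \<Rightarrow> 'a \<Rightarrow> real) \<Rightarrow> nat \<Rightarrow> real \<Rightarrow> 'a \<Rightarrow> real" where
  "empirical_distribution X n t \<omega> = (1 / real n) * (\<Sum>i=1..n. of_bool (\<Phi> (X i \<omega>) \<le> t))"

text \<open>
  Measurability is part of the definition, because \<^const>\<open>measure\<close> is \<open>0\<close> on non-measurable sets.
\<close>

definition converges_in_probability ::
    "'a measure \<Rightarrow> (nat \<Rightarrow> 'a \<Rightarrow> real) \<Rightarrow> ('a \<Rightarrow> real) \<Rightarrow> bool" where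
  "converges_in_probability M Y Z \<longleftrightarrow>
     (\<forall>n. Y n \<in> borel_measurable M) \<and> Z \<in> borel_measurable M \<and>
     (\<forall>\<epsilon>>0. (\<lambda>n. measure M {\<omega> \<in> space M. \<bar>Y n \<omega> - Z \<omega>\<bar> > \<epsilon>}) \<longlonglongrightarrow> 0)"

end

theory Submission
  imports Defs
begin

text \<open>
  For fixed \<open>0 < t < 1\<close> the event \<open>\<Phi> (X i) \<le> t\<close> is a half-line event \<open>X i \<le> a\<close> with \<open>\<Phi> a = t\<close>. The pair
  \<open>(X i, X j)\<close> has the law of \<open>(Z, \<rho> Z + sqrt (1 - \<rho>\<^sup>2) W)\<close> with \<open>Z, W\<close> independent standard Gaussians and
  \<open>\<rho>\<close> the covariance (\<open>standardized_gaussian_pair_law\<close>). So the probability that both variables are at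
  most \<open>a\<close> is a function of \<open>\<rho>\<close> alone, and it tends to \<open>(\<Phi> a)\<^sup>2\<close> as \<open>\<rho> \<rightarrow> 0\<close>, by dominated convergence
  (\<open>gaussian_half_lines_decorrelate\<close>). The pair law rests on the invariance of the planar Gaussian
  measure under orthogonal maps (\<open>distr_gauss2_rotate\<close>).

  As \<open>\<rho>\<close> is bounded by \<open>r (\<bar>i - j\<bar>)\<close>, the half-line events at distant indices are nearly uncorrelated,
  whence the variance of the empirical distribution at \<open>t\<close> tends to \<open>0\<close>: all but \<open>O(n)\<close> of the \<open>n\<^sup>2\<close>
  covariances are small (\<open>weak_law_decorrelated_events\<close>). This gives convergence in probability at
  each \<open>t\<close>.

  The expected empirical distribution is the uniform distribution function on \<open>[0, 1]\<close>. It is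
  continuous and the empirical distribution is monotone, so closeness on a finite grid implies uniform
  closeness (\<open>cdf_deviation_le_grid_deviation\<close>). The supremum is measurable because both functions are
  right continuous.
\<close>

section \<open>Orthogonal invariance of the planar Gaussian measure\<close>

abbreviation gauss2 :: "(real \<times> real) measure" where
  "gauss2 \<equiv> std_normal_distribution \<Otimes>\<^sub>M std_normal_distribution"

interpretation std_normal: real_distribution std_normal_distribution
  by (rule real_dist_normal_dist)

interpretation gauss2: pair_prob_space std_normal_distribution std_normal_distribution ..

lemma sets_gauss2 [measurable_cong]: "sets gauss2 = sets (borel \<Otimes>\<^sub>M borel)"
  by (intro sets_pair_measure_cong) simp_all

lemma gauss2_eq_density:
  "gauss2 = density (lborel \<Otimes>\<^sub>M lborel)
     (\<lambda>(x, y). ennreal (std_normal_density x) * ennreal (std_normal_density y))"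
  by (rule pair_measure_density)
     (auto intro: std_normal.sigma_finite_measure_axioms lborel.sigma_finite_measure_axioms)

lemma nn_integral_gauss2:
  assumes [measurable]: "f \<in> borel_measurable (borel \<Otimes>\<^sub>M borel)"
  shows "(\<integral>\<^sup>+z. f z \<partial>gauss2) =
    (\<integral>\<^sup>+y. \<integral>\<^sup>+x. ennreal (std_normal_density x * std_normal_density y) * f (x, y) \<partial>lborel \<partial>lborel)"
proof -
  have "(\<integral>\<^sup>+z. f z \<partial>gauss2) =
    (\<integral>\<^sup>+z. (case z of (x, y) \<Rightarrow> ennreal (std_normal_density x * std_normal_density y) * f (x, y))
      \<partial>(lborel \<Otimes>\<^sub>M lborel))"
    unfolding gauss2_eq_density
    by (subst nn_integral_density)
       (auto intro!: nn_integral_cong simp: ennreal_mult split: prod.splits)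
  also have "\<dots> = (\<integral>\<^sup>+y. \<integral>\<^sup>+x. ennreal (std_normal_density x * std_normal_density y) * f (x, y) \<partial>lborel \<partial>lborel)"
    by (subst lborel_pair.nn_integral_snd[symmetric]) auto
  finally show ?thesis .
qed

lemma std_normal_density_mult:
  "std_normal_density x * std_normal_density y = exp (- (x\<^sup>2 + y\<^sup>2) / 2) / (2 * pi)"
  by (simp add: std_normal_density_def exp_add[symmetric] field_simps)

text \<open>
  The joint density depends only on \<open>x\<^sup>2 + y\<^sup>2\<close>, which an orthogonal matrix preserves. That Lebesgue
  measure is preserved too is seen by factoring the matrix into one-dimensional affine substitutions:
  for \<open>p \<noteq> 0\<close>, the first coordinate replaces \<open>x\<close> at fixed \<open>y\<close>, with Jacobian \<open>1 / p\<close>, and after Fubini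
  the second coordinate replaces \<open>y\<close>, with Jacobian \<open>p\<close>. The sign \<open>s\<close> distinguishes rotations from
  reflections.
\<close>

lemma nn_integral_gauss2_rotate:
  fixes p q s :: real
  assumes pq: "p\<^sup>2 + q\<^sup>2 = 1" and s: "s\<^sup>2 = 1"
    and f [measurable]: "f \<in> borel_measurable (borel \<Otimes>\<^sub>M borel)"
  shows "(\<integral>\<^sup>+(x, y). f (p * x + q * y, s * (p * y - q * x)) \<partial>gauss2) = (\<integral>\<^sup>+z. f z \<partial>gauss2)"
proof -
  define g where "g = (\<lambda>r::real. ennreal (exp (- r / 2) / (2 * pi)))"
  have [measurable]: "g \<in> borel_measurable borel" unfolding g_def by measurable
  have lhs: "(\<integral>\<^sup>+(x, y). f (p * x + q * y, s * (p * y - q * x)) \<partial>gauss2) =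
    (\<integral>\<^sup>+y. \<integral>\<^sup>+x. g (x\<^sup>2 + y\<^sup>2) * f (p * x + q * y, s * (p * y - q * x)) \<partial>lborel \<partial>lborel)"
    by (subst nn_integral_gauss2) (simp_all only: std_normal_density_mult g_def prod.case, measurable)
  have rhs: "(\<integral>\<^sup>+z. f z \<partial>gauss2) = (\<integral>\<^sup>+y. \<integral>\<^sup>+x. g (x\<^sup>2 + y\<^sup>2) * f (x, y) \<partial>lborel \<partial>lborel)"
    by (subst nn_integral_gauss2) (simp_all only: std_normal_density_mult g_def prod.case, measurable)
  have s0: "s \<noteq> 0" and s1: "\<bar>s\<bar> = 1" using s by (auto simp: power2_eq_1_iff)
  have ss: "s * (s * a) = a" for a using s by (auto simp: power2_eq_1_iff)
  show ?thesis
  proof (cases "p = 0")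
    case True
    then have q: "q\<^sup>2 = 1" using pq by simp
    then have q0: "q \<noteq> 0" and q1: "\<bar>q\<bar> = 1" by (auto simp: power2_eq_1_iff)
    have qq: "q * (q * a) = a" for a using q by (auto simp: power2_eq_1_iff)
    have "(\<integral>\<^sup>+y. \<integral>\<^sup>+x. g (x\<^sup>2 + y\<^sup>2) * f (q * y, - (s * q * x)) \<partial>lborel \<partial>lborel) =
        (\<integral>\<^sup>+y. \<integral>\<^sup>+x. g (x\<^sup>2 + y\<^sup>2) * f (q * y, x) \<partial>lborel \<partial>lborel)"
      by (rule nn_integral_cong, subst nn_integral_real_affine[where c = "- (s * q)" and t = 0])
         (use s0 q0 s1 q1 s q in \<open>simp_all add: abs_mult power_mult_distrib ss qq mult.left_commute mult.assoc\<close>)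
    also have "\<dots> = (\<integral>\<^sup>+x. \<integral>\<^sup>+y. g (x\<^sup>2 + y\<^sup>2) * f (q * y, x) \<partial>lborel \<partial>lborel)"
      by (subst lborel_pair.Fubini') auto
    also have "\<dots> = (\<integral>\<^sup>+x. \<integral>\<^sup>+y. g (x\<^sup>2 + y\<^sup>2) * f (y, x) \<partial>lborel \<partial>lborel)"
      by (rule nn_integral_cong, subst nn_integral_real_affine[where c = q and t = 0])
         (use q0 q1 q in \<open>simp_all add: power_mult_distrib qq\<close>)
    finally show ?thesis unfolding lhs rhs using True by (simp add: add.commute mult.assoc)
  next
    case False
    have "(\<integral>\<^sup>+y. \<integral>\<^sup>+x. g (x\<^sup>2 + y\<^sup>2) * f (p * x + q * y, s * (p * y - q * x)) \<partial>lborel \<partial>lborel) =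
        (\<integral>\<^sup>+y. \<bar>1 / p\<bar> * (\<integral>\<^sup>+u. g (((u - q * y) / p)\<^sup>2 + y\<^sup>2) * f (u, s * ((y - q * u) / p)) \<partial>lborel) \<partial>lborel)"
    proof (rule nn_integral_cong)
      fix y
      have u: "- (q * y / p) + 1 / p * u = (u - q * y) / p" "p * ((u - q * y) / p) + q * y = u" for u
        using False by (simp_all add: field_simps)
      have v: "p * y - q * ((u - q * y) / p) = (y - q * u) / p" for u
      proof -
        have "p * y - q * ((u - q * y) / p) = ((p\<^sup>2 + q\<^sup>2) * y - q * u) / p"
          using False by (simp add: field_simps power2_eq_square)
        then show ?thesis using pq by simp
      qed
      show "(\<integral>\<^sup>+x. g (x\<^sup>2 + y\<^sup>2) * f (p * x + q * y, s * (p * y - q * x)) \<partial>lborel) =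
        \<bar>1 / p\<bar> * (\<integral>\<^sup>+u. g (((u - q * y) / p)\<^sup>2 + y\<^sup>2) * f (u, s * ((y - q * u) / p)) \<partial>lborel)"
        using False
        by (subst nn_integral_real_affine[where c = "1 / p" and t = "- (q * y / p)"])
           (simp_all only: u v, simp_all)
    qed
    also have "\<dots> = \<bar>1 / p\<bar> * (\<integral>\<^sup>+y. \<integral>\<^sup>+u. g (((u - q * y) / p)\<^sup>2 + y\<^sup>2) * f (u, s * ((y - q * u) / p)) \<partial>lborel \<partial>lborel)"
      by (subst nn_integral_cmult) auto
    also have "\<dots> = \<bar>1 / p\<bar> * (\<integral>\<^sup>+u. \<integral>\<^sup>+y. g (((u - q * y) / p)\<^sup>2 + y\<^sup>2) * f (u, s * ((y - q * u) / p)) \<partial>lborel \<partial>lborel)"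
      by (subst lborel_pair.Fubini') auto
    also have "\<dots> = \<bar>1 / p\<bar> * (\<integral>\<^sup>+u. \<bar>p\<bar> * (\<integral>\<^sup>+v. g (u\<^sup>2 + v\<^sup>2) * f (u, v) \<partial>lborel) \<partial>lborel)"
    proof (intro arg_cong[where f = "\<lambda>a. ennreal \<bar>1 / p\<bar> * a"] nn_integral_cong)
      fix u
      have *: "((u - q * (q * u + s * p * v)) / p)\<^sup>2 + (q * u + s * p * v)\<^sup>2 = u\<^sup>2 + v\<^sup>2" for v
      proof -
        have "u - q * (q * u + s * p * v) = (p\<^sup>2 + q\<^sup>2) * u - q * (q * u + s * p * v)" using pq by simp
        also have "\<dots> = p * (p * u - q * s * v)" by (simp add: algebra_simps power2_eq_square)
        finally have "(u - q * (q * u + s * p * v)) / p = p * u - q * s * v" using False by simp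
        moreover have "(p * u - q * s * v)\<^sup>2 + (q * u + s * p * v)\<^sup>2 = (p\<^sup>2 + q\<^sup>2) * (u\<^sup>2 + s\<^sup>2 * v\<^sup>2)"
          by (simp add: algebra_simps power2_eq_square)
        ultimately show ?thesis using pq s by simp
      qed
      show "(\<integral>\<^sup>+y. g (((u - q * y) / p)\<^sup>2 + y\<^sup>2) * f (u, s * ((y - q * u) / p)) \<partial>lborel) =
        \<bar>p\<bar> * (\<integral>\<^sup>+v. g (u\<^sup>2 + v\<^sup>2) * f (u, v) \<partial>lborel)"
        using False s0 s1
        by (subst nn_integral_real_affine[where c = "s * p" and t = "q * u"])
           (simp_all add: * abs_mult ss)
    qed
    also have "\<dots> = \<bar>1 / p\<bar> * (\<bar>p\<bar> * (\<integral>\<^sup>+u. \<integral>\<^sup>+v. g (u\<^sup>2 + v\<^sup>2) * f (u, v) \<partial>lborel \<partial>lborel))"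
      by (subst nn_integral_cmult) auto
    also have "\<dots> = (\<integral>\<^sup>+u. \<integral>\<^sup>+v. g (u\<^sup>2 + v\<^sup>2) * f (u, v) \<partial>lborel \<partial>lborel)"
      using False by (simp add: mult.assoc[symmetric] ennreal_mult[symmetric])
    also have "\<dots> = (\<integral>\<^sup>+y. \<integral>\<^sup>+x. g (x\<^sup>2 + y\<^sup>2) * f (x, y) \<partial>lborel \<partial>lborel)"
      by (subst lborel_pair.Fubini') auto
    finally show ?thesis unfolding lhs rhs .
  qed
qed

lemma distr_gauss2_rotate:
  fixes p q s :: real
  assumes "p\<^sup>2 + q\<^sup>2 = 1" "s\<^sup>2 = 1"
  shows "distr gauss2 (borel \<Otimes>\<^sub>M borel) (\<lambda>(x, y). (p * x + q * y, s * (p * y - q * x))) = gauss2"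
    (is "distr _ _ ?T = _")
proof (rule measure_eqI)
  fix A assume "A \<in> sets (distr gauss2 (borel \<Otimes>\<^sub>M borel) ?T)"
  then have A [measurable]: "A \<in> sets (borel \<Otimes>\<^sub>M borel)" by simp
  have "emeasure (distr gauss2 (borel \<Otimes>\<^sub>M borel) ?T) A = (\<integral>\<^sup>+z. indicator A z \<partial>distr gauss2 (borel \<Otimes>\<^sub>M borel) ?T)"
    by simp
  also have "\<dots> = (\<integral>\<^sup>+z. indicator A (?T z) \<partial>gauss2)"
    by (subst nn_integral_distr) auto
  also have "\<dots> = (\<integral>\<^sup>+z. indicator A z \<partial>gauss2)"
    using nn_integral_gauss2_rotate[OF assms, of "indicator A"] by (simp add: case_prod_unfold)
  also have "\<dots> = emeasure gauss2 A"
    using A sets_gauss2 by (intro nn_integral_indicator) blast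
  finally show "emeasure (distr gauss2 (borel \<Otimes>\<^sub>M borel) ?T) A = emeasure gauss2 A" .
qed (simp add: sets_gauss2)

lemma distr_PiM_pair_std_normal:
  assumes "i \<noteq> j"
  shows "distr (PiM {i, j} (\<lambda>_. std_normal_distribution)) (borel \<Otimes>\<^sub>M borel) (\<lambda>z. (z i, z j)) = gauss2"
proof -
  let ?P = "PiM {i, j} (\<lambda>_. std_normal_distribution)"
  interpret P: product_prob_space "\<lambda>_. std_normal_distribution" "{i, j}" ..
  have [measurable]: "(\<lambda>z. (z i, z j)) \<in> measurable ?P (borel \<Otimes>\<^sub>M borel)"
    by measurable
  have "gauss2 = distr ?P (borel \<Otimes>\<^sub>M borel) (\<lambda>z. (z i, z j))"
  proof (rule pair_measure_eqI)
    fix A B :: "real set" assume "A \<in> sets std_normal_distribution" "B \<in> sets std_normal_distribution"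
    then have [measurable]: "A \<in> sets borel" "B \<in> sets borel" by simp_all
    have eq: "(\<lambda>z. (z i, z j)) -` (A \<times> B) \<inter> space ?P = PiE {i, j} (\<lambda>k. if k = i then A else B)"
      using assms by (auto simp: space_PiM PiE_iff)
    have "emeasure (distr ?P (borel \<Otimes>\<^sub>M borel) (\<lambda>z. (z i, z j))) (A \<times> B) = emeasure ?P (PiE {i, j} (\<lambda>k. if k = i then A else B))"
      by (subst emeasure_distr) (auto simp: eq)
    also have "\<dots> = emeasure std_normal_distribution A * emeasure std_normal_distribution B"
      using assms by (subst P.emeasure_PiM) auto
    finally show "emeasure std_normal_distribution A * emeasure std_normal_distribution B =
      emeasure (distr ?P (borel \<Otimes>\<^sub>M borel) (\<lambda>z. (z i, z j))) (A \<times> B)" by simp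
  qed (auto simp: sets_gauss2 intro: std_normal.sigma_finite_measure_axioms)
  then show ?thesis by simp
qed

section \<open>Pair laws of a standardized Gaussian process\<close>

lemma std_normal_moments:
  "integrable std_normal_distribution (\<lambda>x. x)" "integrable std_normal_distribution (\<lambda>x. x\<^sup>2)"
  "(\<integral>x. x \<partial>std_normal_distribution) = 0" "(\<integral>x. x\<^sup>2 \<partial>std_normal_distribution) = 1"
  using integrable_std_normal_distribution_moment[of 1] integrable_std_normal_distribution_moment[of 2]
    integral_std_normal_distribution_moment_odd[of 1] std_normal_distribution_even_moments[of 1]
  by (simp_all add: fact_2)

lemma distr_gauss2_fst: "distr gauss2 std_normal_distribution fst = std_normal_distribution"
  and distr_gauss2_snd: "distr gauss2 std_normal_distribution snd = std_normal_distribution"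
proof -
  show fst: "distr gauss2 std_normal_distribution fst = std_normal_distribution"
    by (rule std_normal.distr_pair_fst)
  have "distr gauss2 std_normal_distribution snd =
      distr (distr gauss2 gauss2 (\<lambda>(x, y). (y, x))) std_normal_distribution snd"
    using gauss2.distr_pair_swap by simp
  also have "\<dots> = distr gauss2 std_normal_distribution fst"
    by (subst distr_distr) (auto simp: comp_def case_prod_unfold)
  finally show "distr gauss2 std_normal_distribution snd = std_normal_distribution"
    using fst by simp
qed

text \<open>
  These determine the mean and covariance matrix of any affine image of the standard Gaussian pair.
\<close>

lemma gauss2_moments:
  "integrable gauss2 fst" "integrable gauss2 snd"
  "integrable gauss2 (\<lambda>z. (fst z)\<^sup>2)" "integrable gauss2 (\<lambda>z. (snd z)\<^sup>2)"
  "integrable gauss2 (\<lambda>z. fst z * snd z)"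
  "(\<integral>z. fst z \<partial>gauss2) = 0" "(\<integral>z. snd z \<partial>gauss2) = 0"
  "(\<integral>z. (fst z)\<^sup>2 \<partial>gauss2) = 1" "(\<integral>z. (snd z)\<^sup>2 \<partial>gauss2) = 1"
  "(\<integral>z. fst z * snd z \<partial>gauss2) = 0"
proof -
  have f: "integrable gauss2 (\<lambda>z. g (fst z)) \<longleftrightarrow> integrable std_normal_distribution g"
     "(\<integral>z. g (fst z) \<partial>gauss2) = (\<integral>x. g x \<partial>std_normal_distribution)"
    if [measurable]: "g \<in> borel_measurable borel" for g :: "real \<Rightarrow> real"
    using integrable_distr_eq[of fst gauss2 std_normal_distribution g] integral_distr[of fst gauss2 std_normal_distribution g]
    unfolding distr_gauss2_fst by simp_all
  have s: "integrable gauss2 (\<lambda>z. g (snd z)) \<longleftrightarrow> integrable std_normal_distribution g"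
     "(\<integral>z. g (snd z) \<partial>gauss2) = (\<integral>x. g x \<partial>std_normal_distribution)"
    if [measurable]: "g \<in> borel_measurable borel" for g :: "real \<Rightarrow> real"
    using integrable_distr_eq[of snd gauss2 std_normal_distribution g] integral_distr[of snd gauss2 std_normal_distribution g]
    unfolding distr_gauss2_snd by simp_all
  have id: "(\<lambda>x::real. x) \<in> borel_measurable borel" and sq: "(\<lambda>x::real. x\<^sup>2) \<in> borel_measurable borel"
    by simp_all
  note moments = f[OF id] f[OF sq] s[OF id] s[OF sq]
  show 1: "integrable gauss2 fst" "integrable gauss2 snd"
    "integrable gauss2 (\<lambda>z. (fst z)\<^sup>2)" "integrable gauss2 (\<lambda>z. (snd z)\<^sup>2)"
    "(\<integral>z. fst z \<partial>gauss2) = 0" "(\<integral>z. snd z \<partial>gauss2) = 0"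
    "(\<integral>z. (fst z)\<^sup>2 \<partial>gauss2) = 1" "(\<integral>z. (snd z)\<^sup>2 \<partial>gauss2) = 1"
    unfolding moments by (rule std_normal_moments)+
  show int: "integrable gauss2 (\<lambda>z. fst z * snd z)"
  proof (rule Bochner_Integration.integrable_bound)
    show "integrable gauss2 (\<lambda>z. (fst z)\<^sup>2 + (snd z)\<^sup>2)" using 1 by simp
    have "\<bar>x * y\<bar> \<le> \<bar>x\<^sup>2 + y\<^sup>2\<bar>" for x y :: real
    proof -
      have "0 \<le> (\<bar>x\<bar> - \<bar>y\<bar>)\<^sup>2" by simp
      then have "2 * \<bar>x * y\<bar> \<le> x\<^sup>2 + y\<^sup>2" by (simp add: power2_diff abs_mult)
      moreover have "0 \<le> \<bar>x * y\<bar>" by simp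
      ultimately show ?thesis by linarith
    qed
    then show "AE z in gauss2. norm (fst z * snd z) \<le> norm ((fst z)\<^sup>2 + (snd z)\<^sup>2)" by simp
  qed simp
  show "(\<integral>z. fst z * snd z \<partial>gauss2) = 0"
    using gauss2.integral_fst'[of "\<lambda>z. fst z * snd z"] int by (simp add: std_normal_moments)
qed

text \<open>
  The coordinates of the finite product measure indexed by \<open>{i, j}\<close> are an independent pair, so
  the marginal at \<open>{i, j}\<close> can be written with two explicit variables.
\<close>

lemma gaussian_process_pair_law:
  assumes "gaussian_process M I X" "i \<in> I" "j \<in> I" "i \<noteq> j"
  obtains m1 m2 a b c d where
    "distr M (borel \<Otimes>\<^sub>M borel) (\<lambda>\<omega>. (X i \<omega>, X j \<omega>)) =
     distr gauss2 (borel \<Otimes>\<^sub>M borel) (\<lambda>(x, y). (m1 + a * x + b * y, m2 + c * x + d * y))"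
proof -
  let ?J = "{i, j}" and ?P = "PiM {i, j} (\<lambda>_. std_normal_distribution)"
    and ?B = "PiM {i, j} (\<lambda>_. borel :: real measure)"
  have [measurable]: "X i \<in> borel_measurable M" "X j \<in> borel_measurable M"
    and mg: "multivariate_gaussian ?J (distr M ?B (\<lambda>\<omega>. \<lambda>i\<in>?J. X i \<omega>))"
    using assms unfolding gaussian_process_def by auto
  obtain m A where eq: "distr M ?B (\<lambda>\<omega>. \<lambda>i\<in>?J. X i \<omega>) =
      distr ?P ?B (\<lambda>z. \<lambda>i\<in>?J. m i + (\<Sum>j\<in>?J. A i j * z j))"
    using mg unfolding multivariate_gaussian_def by blast
  have X [measurable]: "(\<lambda>\<omega>. \<lambda>i\<in>?J. X i \<omega>) \<in> measurable M ?B"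
    by (intro measurable_restrict) auto
  have Z [measurable]: "(\<lambda>z. \<lambda>i\<in>?J. m i + (\<Sum>j\<in>?J. A i j * z j)) \<in> measurable ?P ?B"
    by (intro measurable_restrict) measurable
  have C [measurable]: "(\<lambda>x. (x i, x j)) \<in> measurable ?B (borel \<Otimes>\<^sub>M borel)" by measurable
  have D [measurable]: "(\<lambda>x. (x i, x j)) \<in> measurable ?P (borel \<Otimes>\<^sub>M borel)" by measurable
  have "distr M (borel \<Otimes>\<^sub>M borel) (\<lambda>\<omega>. (X i \<omega>, X j \<omega>)) =
      distr (distr M ?B (\<lambda>\<omega>. \<lambda>i\<in>?J. X i \<omega>)) (borel \<Otimes>\<^sub>M borel) (\<lambda>x. (x i, x j))"
    by (subst distr_distr[OF C X]) (simp add: comp_def)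
  also have "\<dots> = distr ?P (borel \<Otimes>\<^sub>M borel)
      (\<lambda>z. (m i + A i i * z i + A i j * z j, m j + A j i * z i + A j j * z j))"
    unfolding eq using assms(4)
    by (subst distr_distr[OF C Z]) (simp add: comp_def add.assoc)
  also have "\<dots> = distr (distr ?P (borel \<Otimes>\<^sub>M borel) (\<lambda>z. (z i, z j))) (borel \<Otimes>\<^sub>M borel)
      (\<lambda>(x, y). (m i + A i i * x + A i j * y, m j + A j i * x + A j j * y))"
    by (subst distr_distr[OF _ D]) (simp_all add: comp_def)
  finally show ?thesis
    using that unfolding distr_PiM_pair_std_normal[OF assms(4)] by blast
qed

text \<open>
  The pair law depends on the matrix of the representation only through the covariance. The moments
  make both rows \<open>(a, b)\<close> and \<open>(c, d)\<close> unit vectors with inner product \<open>\<rho>\<close>, so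
  \<open>(a d - b c)\<^sup>2 = 1 - \<rho>\<^sup>2\<close>. Completing \<open>(a, b)\<close> to an orthonormal basis and expanding \<open>(c, d)\<close> in it
  gives coefficients \<open>\<rho>\<close> and \<open>\<plusminus> sqrt (1 - \<rho>\<^sup>2)\<close>; orthogonal invariance does the rest.
\<close>

lemma standardized_gaussian_pair_law:
  fixes X :: "'i \<Rightarrow> 'a \<Rightarrow> real"
  assumes "prob_space M" and sgp: "standardized_gaussian_process M I X" and ij: "i \<in> I" "j \<in> I" "i \<noteq> j"
  defines "\<rho> \<equiv> (\<integral>\<omega>. X i \<omega> * X j \<omega> \<partial>M)"
  shows "distr M (borel \<Otimes>\<^sub>M borel) (\<lambda>\<omega>. (X i \<omega>, X j \<omega>)) =
     distr gauss2 (borel \<Otimes>\<^sub>M borel) (\<lambda>(x, y). (x, \<rho> * x + sqrt (1 - \<rho>\<^sup>2) * y))"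
proof -
  interpret prob_space M by fact
  from sgp ij have [measurable]: "X i \<in> borel_measurable M" "X j \<in> borel_measurable M"
    and Xi: "distributed M lborel (X i) std_normal_density"
    and Xj: "distributed M lborel (X j) std_normal_density"
    and gp: "gaussian_process M I X"
    unfolding standardized_gaussian_process_def gaussian_process_def by auto
  obtain m1 m2 a b c d where law: "distr M (borel \<Otimes>\<^sub>M borel) (\<lambda>\<omega>. (X i \<omega>, X j \<omega>)) =
     distr gauss2 (borel \<Otimes>\<^sub>M borel) (\<lambda>(x, y). (m1 + a * x + b * y, m2 + c * x + d * y))"
    by (rule gaussian_process_pair_law[OF gp ij])
  have transfer: "(\<integral>\<omega>. g (X i \<omega>) (X j \<omega>) \<partial>M) =
      (\<integral>z. g (m1 + a * fst z + b * snd z) (m2 + c * fst z + d * snd z) \<partial>gauss2)"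
    if [measurable]: "case_prod g \<in> borel_measurable (borel \<Otimes>\<^sub>M borel)" for g :: "real \<Rightarrow> real \<Rightarrow> real"
  proof -
    have "(\<integral>\<omega>. g (X i \<omega>) (X j \<omega>) \<partial>M) = (\<integral>z. case_prod g z \<partial>distr M (borel \<Otimes>\<^sub>M borel) (\<lambda>\<omega>. (X i \<omega>, X j \<omega>)))"
      by (subst integral_distr) auto
    also have "\<dots> = (\<integral>z. g (m1 + a * fst z + b * snd z) (m2 + c * fst z + d * snd z) \<partial>gauss2)"
      unfolding law by (subst integral_distr) (auto simp: case_prod_unfold)
    finally show ?thesis .
  qed
  have prod: "(\<integral>z. (p * fst z + q * snd z) * (r * fst z + s * snd z) \<partial>gauss2) = p * r + q * s" for p q r s
  proof -
    have "(\<lambda>z. (p * fst z + q * snd z) * (r * fst z + s * snd z)) =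
      (\<lambda>z::real \<times> real. (p * r) * (fst z)\<^sup>2 + (q * s) * (snd z)\<^sup>2 + (p * s + q * r) * (fst z * snd z))"
      by (auto simp: algebra_simps power2_eq_square)
    then show ?thesis by (simp add: gauss2_moments)
  qed
  have "m1 = (\<integral>\<omega>. X i \<omega> \<partial>M)" "m2 = (\<integral>\<omega>. X j \<omega> \<partial>M)"
    using transfer[of "\<lambda>x y. x"] transfer[of "\<lambda>x y. y"] 
    by (simp_all add: gauss2_moments gauss2.P.prob_space)
  then have m0: "m1 = 0" "m2 = 0"
    using Xi Xj standard_normal_distributed_expectation by auto
  have v: "(\<integral>\<omega>. X k \<omega> * X k \<omega> \<partial>M) = 1" if "distributed M lborel (X k) std_normal_density" for k
    using standard_normal_distributed_variance[OF that] standard_normal_distributed_expectation[OF that]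
    by (simp add: power2_eq_square)
  have ab: "a\<^sup>2 + b\<^sup>2 = 1"
    using transfer[of "\<lambda>x y. x * x"] m0 prod[of a b a b] v[OF Xi] by (simp add: power2_eq_square)
  have cd: "c\<^sup>2 + d\<^sup>2 = 1"
    using transfer[of "\<lambda>x y. y * y"] m0 prod[of c d c d] v[OF Xj] by (simp add: power2_eq_square)
  have \<rho>: "\<rho> = a * c + b * d"
    using transfer[of "\<lambda>x y. x * y"] m0 prod[of a b c d] unfolding \<rho>_def by simp
  \<comment> \<open>The second basis vector is \<open>s (- b, a)\<close>; this choice of orientation makes the coefficient of
    \<open>(c, d)\<close> along it nonnegative, hence equal to \<open>sqrt (1 - \<rho>\<^sup>2)\<close>.\<close>
  define s where "s = (if a * d - b * c \<ge> 0 then 1 else - 1 :: real)"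
  have s: "s\<^sup>2 = 1" "s * s = 1" by (auto simp: s_def)
  have "1 - \<rho>\<^sup>2 = (a\<^sup>2 + b\<^sup>2) * (c\<^sup>2 + d\<^sup>2) - \<rho>\<^sup>2" using ab cd by simp
  also have "\<dots> = (a * d - b * c)\<^sup>2" unfolding \<rho> by (simp add: algebra_simps power2_eq_square)
  finally have \<kappa>: "sqrt (1 - \<rho>\<^sup>2) = s * (a * d - b * c)" by (simp add: s_def)
  have lin: "\<rho> * (a * x + b * y) + sqrt (1 - \<rho>\<^sup>2) * (s * (a * y - b * x)) = c * x + d * y" for x y
  proof -
    have "\<rho> * (a * x + b * y) + sqrt (1 - \<rho>\<^sup>2) * (s * (a * y - b * x)) =
      (a * c + b * d) * (a * x + b * y) + (s * s) * ((a * d - b * c) * (a * y - b * x))"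
      unfolding \<kappa> unfolding \<rho> by (simp only: mult_ac)
    also have "\<dots> = (a\<^sup>2 + b\<^sup>2) * (c * x + d * y)"
      unfolding s by (simp add: algebra_simps power2_eq_square)
    finally show ?thesis using ab by simp
  qed
  have "distr gauss2 (borel \<Otimes>\<^sub>M borel) (\<lambda>(x, y). (x, \<rho> * x + sqrt (1 - \<rho>\<^sup>2) * y)) =
    distr (distr gauss2 (borel \<Otimes>\<^sub>M borel) (\<lambda>(x, y). (a * x + b * y, s * (a * y - b * x)))) (borel \<Otimes>\<^sub>M borel)
      (\<lambda>(x, y). (x, \<rho> * x + sqrt (1 - \<rho>\<^sup>2) * y))"
    unfolding distr_gauss2_rotate[OF ab s(1)] ..
  also have "\<dots> = distr gauss2 (borel \<Otimes>\<^sub>M borel) (\<lambda>(x, y). (a * x + b * y, c * x + d * y))"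
    by (subst distr_distr) (auto simp: comp_def case_prod_unfold lin)
  finally show ?thesis using law m0 by simp
qed

section \<open>Asymptotic independence of half-lines\<close>

lemma emeasure_std_normal_singleton: "emeasure std_normal_distribution {x} = 0"
  by (subst emeasure_density) (simp_all add: nn_integral_indicator_singleton)

text \<open>
  As \<open>\<rho> \<rightarrow> 0\<close>, the indicator of the event converges pointwise except where \<open>y = a\<close>, which is a null
  set because the Gaussian law has no atoms; dominated convergence then applies.
\<close>

lemma isCont_gauss2_orthant:
  "isCont (\<lambda>\<rho>. measure gauss2 {(x, y). x \<le> a \<and> \<rho> * x + sqrt (1 - \<rho>\<^sup>2) * y \<le> a}) 0"
proof -
  define S where "S \<rho> = {z. fst z \<le> a \<and> \<rho> * fst z + sqrt (1 - \<rho>\<^sup>2) * snd z \<le> a}" for \<rho> :: real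
  have S [measurable]: "S \<rho> \<in> sets (borel \<Otimes>\<^sub>M borel)" for \<rho>
  proof -
    have "{z \<in> space (borel \<Otimes>\<^sub>M borel). fst z \<le> a \<and> \<rho> * fst z + sqrt (1 - \<rho>\<^sup>2) * snd z \<le> a} \<in> sets (borel \<Otimes>\<^sub>M borel)"
      by measurable
    then show ?thesis by (simp add: S_def space_pair_measure)
  qed
  then have S': "S \<rho> \<in> sets gauss2" for \<rho> using sets_gauss2 by blast
  have "(\<lambda>n. measure gauss2 (S (r n))) \<longlonglongrightarrow> measure gauss2 (S 0)" if r: "r \<longlonglongrightarrow> 0" for r
  proof -
    have "(\<lambda>n. \<integral>z. indicat_real (S (r n)) z \<partial>gauss2) \<longlonglongrightarrow> (\<integral>z. indicat_real (S 0) z \<partial>gauss2)"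
    proof (rule integral_dominated_convergence[where w = "\<lambda>_. 1"])
      have "AE y in distr gauss2 std_normal_distribution snd. y \<noteq> a"
        unfolding distr_gauss2_snd
        by (rule AE_I[of _ _ "{a}"]) (auto simp: emeasure_std_normal_singleton)
      then have "AE z in gauss2. snd z \<noteq> a" by (subst (asm) AE_distr_iff) auto
      then show "AE z in gauss2. (\<lambda>n. indicat_real (S (r n)) z) \<longlonglongrightarrow> indicat_real (S 0) z"
      proof eventually_elim
        case (elim z)
        have lim: "(\<lambda>n. r n * fst z + sqrt (1 - (r n)\<^sup>2) * snd z) \<longlonglongrightarrow> 0 * fst z + sqrt (1 - 0\<^sup>2) * snd z"
          by (intro tendsto_intros r)
        have "eventually (\<lambda>n. r n * fst z + sqrt (1 - (r n)\<^sup>2) * snd z \<le> a \<longleftrightarrow> snd z \<le> a) sequentially"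
        proof (cases "snd z < a")
          case True
          then show ?thesis using order_tendstoD(2)[OF lim, of a] by (auto elim!: eventually_mono)
        next
          case False
          then have "a < snd z" using elim by simp
          then show ?thesis using order_tendstoD(1)[OF lim, of a] by (auto elim!: eventually_mono)
        qed
        then have "eventually (\<lambda>n. indicat_real (S (r n)) z = indicat_real (S 0) z) sequentially"
          by eventually_elim (auto simp: S_def indicator_def)
        then show ?case by (rule tendsto_eventually)
      qed
    qed (use S' in \<open>auto simp: indicator_def\<close>)
    then show ?thesis using S' by simp
  qed
  then have "isCont (\<lambda>\<rho>. measure gauss2 (S \<rho>)) 0"
    unfolding continuous_at_sequentially by (simp add: comp_def)
  then show ?thesis by (simp add: S_def case_prod_unfold)
qed

lemma measure_gauss2_orthant_0:
  "measure gauss2 {(x, y). x \<le> a \<and> 0 * x + sqrt (1 - 0\<^sup>2) * y \<le> a} = (\<Phi> a)\<^sup>2"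
proof -
  have "{(x, y). x \<le> a \<and> 0 * x + sqrt (1 - 0\<^sup>2) * y \<le> a} = {..a} \<times> {..a}" by auto
  then show ?thesis
    by (simp add: measure_def std_normal.emeasure_pair_measure_Times enn2real_mult \<Phi>_def cdf_def power2_eq_square)
qed

lemma distributed_std_normal_le:
  assumes "prob_space M" "distributed M lborel Y std_normal_density"
  shows "measure M {\<omega> \<in> space M. Y \<omega> \<le> a} = \<Phi> a"
proof -
  have [measurable]: "Y \<in> borel_measurable M" using distributed_measurable[OF assms(2)] by simp
  have "\<Phi> a = measure (distr M lborel Y) {..a}"
    using distributed_distr_eq_density[OF assms(2)] by (simp add: \<Phi>_def cdf_def)
  also have "\<dots> = measure M {\<omega> \<in> space M. Y \<omega> \<le> a}"
    by (subst measure_distr) (auto intro!: arg_cong[where f = "measure M"])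
  finally show ?thesis ..
qed

text \<open>
  The probability of the intersection is a function of the correlation alone, continuous at \<open>0\<close> with
  value \<open>(\<Phi> a)\<^sup>2\<close>. Since this function is the same for every pair, \<open>\<delta>\<close> is uniform in \<open>i\<close> and \<open>j\<close>.
\<close>

lemma gaussian_half_lines_decorrelate:
  fixes X :: "'i \<Rightarrow> 'a \<Rightarrow> real"
  assumes M: "prob_space M" and sgp: "standardized_gaussian_process M I X" and \<epsilon>: "\<epsilon> > 0"
  obtains \<delta> where "\<delta> > 0"
    "\<And>i j. i \<in> I \<Longrightarrow> j \<in> I \<Longrightarrow> i \<noteq> j \<Longrightarrow> \<bar>\<integral>\<omega>. X i \<omega> * X j \<omega> \<partial>M\<bar> < \<delta> \<Longrightarrow>
       \<bar>measure M ({\<omega> \<in> space M. X i \<omega> \<le> a} \<inter> {\<omega> \<in> space M. X j \<omega> \<le> a})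
         - measure M {\<omega> \<in> space M. X i \<omega> \<le> a} * measure M {\<omega> \<in> space M. X j \<omega> \<le> a}\<bar> < \<epsilon>"
proof -
  let ?S = "\<lambda>\<rho>::real. {(x, y). x \<le> a \<and> \<rho> * x + sqrt (1 - \<rho>\<^sup>2) * y \<le> a}"
  obtain \<delta> where \<delta>: "\<delta> > 0" "\<And>\<rho>. \<bar>\<rho>\<bar> < \<delta> \<Longrightarrow> \<bar>measure gauss2 (?S \<rho>) - (\<Phi> a)\<^sup>2\<bar> < \<epsilon>"
    using isCont_gauss2_orthant[of a, unfolded continuous_at_eps_delta, rule_format, OF \<epsilon>]
    unfolding measure_gauss2_orthant_0 dist_real_def by auto
  show ?thesis
  proof (rule that[OF \<delta>(1)])
    fix i j
    assume ij: "i \<in> I" "j \<in> I" "i \<noteq> j" and small: "\<bar>\<integral>\<omega>. X i \<omega> * X j \<omega> \<partial>M\<bar> < \<delta>"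
    define \<rho> where "\<rho> = (\<integral>\<omega>. X i \<omega> * X j \<omega> \<partial>M)"
    have [measurable]: "X i \<in> borel_measurable M" "X j \<in> borel_measurable M"
      and D: "distributed M lborel (X i) std_normal_density" "distributed M lborel (X j) std_normal_density"
      using sgp ij unfolding standardized_gaussian_process_def gaussian_process_def by auto
    have T: "(\<lambda>(x, y). (x, \<rho> * x + sqrt (1 - \<rho>\<^sup>2) * y)) \<in> measurable gauss2 (borel \<Otimes>\<^sub>M borel)"
      by measurable
    have A: "{..a} \<times> {..a} \<in> sets (borel \<Otimes>\<^sub>M borel :: (real \<times> real) measure)" by simp
    have "measure M ({\<omega> \<in> space M. X i \<omega> \<le> a} \<inter> {\<omega> \<in> space M. X j \<omega> \<le> a}) =
        measure (distr M (borel \<Otimes>\<^sub>M borel) (\<lambda>\<omega>. (X i \<omega>, X j \<omega>))) ({..a} \<times> {..a})"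
      by (subst measure_distr) (auto intro!: arg_cong[where f = "measure M"])
    also have "\<dots> = measure gauss2 (?S \<rho>)"
      unfolding standardized_gaussian_pair_law[OF M sgp ij, folded \<rho>_def] measure_distr[OF T A]
      by (rule arg_cong[where f = "measure gauss2"]) (auto simp: space_pair_measure)
    finally show "\<bar>measure M ({\<omega> \<in> space M. X i \<omega> \<le> a} \<inter> {\<omega> \<in> space M. X j \<omega> \<le> a})
         - measure M {\<omega> \<in> space M. X i \<omega> \<le> a} * measure M {\<omega> \<in> space M. X j \<omega> \<le> a}\<bar> < \<epsilon>"
      using \<delta>(2)[of \<rho>] small D
      by (simp add: distributed_std_normal_le[OF M] power2_eq_square \<rho>_def)
  qed
qed

section \<open>A weak law of large numbers\<close>

lemma (in prob_space) centered_indicator_products: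
  assumes [measurable]: "A \<in> events" "B \<in> events"
  shows "integrable M (\<lambda>\<omega>. (indicat_real A \<omega> - prob A) * (indicat_real B \<omega> - prob B))"
    and "expectation (\<lambda>\<omega>. (indicat_real A \<omega> - prob A) * (indicat_real B \<omega> - prob B)) =
      prob (A \<inter> B) - prob A * prob B"
proof -
  have eq: "(\<lambda>\<omega>. (indicat_real A \<omega> - prob A) * (indicat_real B \<omega> - prob B)) =
    (\<lambda>\<omega>. indicat_real (A \<inter> B) \<omega> - prob B * indicat_real A \<omega> - prob A * indicat_real B \<omega> + prob A * prob B)"
    by (auto simp: indicator_def algebra_simps)
  show "integrable M (\<lambda>\<omega>. (indicat_real A \<omega> - prob A) * (indicat_real B \<omega> - prob B))"
    unfolding eq by (auto simp: less_top[symmetric])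
  show "expectation (\<lambda>\<omega>. (indicat_real A \<omega> - prob A) * (indicat_real B \<omega> - prob B)) =
      prob (A \<inter> B) - prob A * prob B"
    unfolding eq by (simp add: less_top[symmetric] prob_space)
qed

text \<open>
  Chebyshev's inequality reduces the claim to showing that the second moment of the centred sum is
  \<open>o(n\<^sup>2)\<close>. That moment is the sum of all \<open>n\<^sup>2\<close> covariances: those with \<open>\<bar>i - j\<bar> \<ge> K\<close> contribute at
  most \<open>\<eta>\<close> each, and each of the at most \<open>2 K n\<close> others contributes at most \<open>1\<close>.
\<close>

lemma (in prob_space) weak_law_decorrelated_events:
  assumes E: "\<And>i. i \<ge> 1 \<Longrightarrow> E i \<in> events"
    and decorr: "\<And>\<eta>. \<eta> > 0 \<Longrightarrow> \<exists>K::nat. \<forall>i\<ge>1. \<forall>j\<ge>1. real K \<le> \<bar>real i - real j\<bar> \<longrightarrow>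
       prob (E i \<inter> E j) - prob (E i) * prob (E j) \<le> \<eta>"
    and \<epsilon>: "\<epsilon> > 0"
  shows "(\<lambda>n. prob {\<omega> \<in> space M. \<bar>1 / real n * (\<Sum>i=1..n. indicat_real (E i) \<omega> - prob (E i))\<bar> > \<epsilon>}) \<longlonglongrightarrow> 0"
proof -
  define S where "S n \<omega> = (\<Sum>i=1..n. indicat_real (E i) \<omega> - prob (E i))" for n \<omega>
  have [measurable]: "S n \<in> borel_measurable M" for n
    unfolding S_def using E by (intro borel_measurable_sum borel_measurable_diff borel_measurable_indicator) auto
  have sq: "(S n \<omega>)\<^sup>2 = (\<Sum>i=1..n. \<Sum>j=1..n.
      (indicat_real (E i) \<omega> - prob (E i)) * (indicat_real (E j) \<omega> - prob (E j)))" for n \<omega>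
    by (simp add: S_def power2_eq_square sum_product)
  have int: "integrable M (\<lambda>\<omega>. (S n \<omega>)\<^sup>2)" for n
    unfolding sq using E by (intro Bochner_Integration.integrable_sum centered_indicator_products) auto
  have second_moment: "expectation (\<lambda>\<omega>. (S n \<omega>)\<^sup>2) \<le> \<eta> * (real n)\<^sup>2 + 2 * real K * real n"
    if \<eta>: "\<eta> > 0" and K: "\<And>i j. i \<ge> 1 \<Longrightarrow> j \<ge> 1 \<Longrightarrow> real K \<le> \<bar>real i - real j\<bar> \<Longrightarrow>
       prob (E i \<inter> E j) - prob (E i) * prob (E j) \<le> \<eta>" for \<eta> K n
  proof -
    let ?Y = "\<lambda>i \<omega>. indicat_real (E i) \<omega> - prob (E i)"
    have intY: "integrable M (\<lambda>\<omega>. ?Y i \<omega> * ?Y j \<omega>)" if "i \<in> {1..n}" "j \<in> {1..n}" for i j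
      using that E by (intro centered_indicator_products) auto
    have "expectation (\<lambda>\<omega>. (S n \<omega>)\<^sup>2) = (\<Sum>i=1..n. expectation (\<lambda>\<omega>. \<Sum>j=1..n. ?Y i \<omega> * ?Y j \<omega>))"
      unfolding sq by (intro Bochner_Integration.integral_sum Bochner_Integration.integrable_sum intY)
    also have "\<dots> = (\<Sum>i=1..n. \<Sum>j=1..n. expectation (\<lambda>\<omega>. ?Y i \<omega> * ?Y j \<omega>))"
      by (intro sum.cong refl Bochner_Integration.integral_sum intY)
    also have "\<dots> = (\<Sum>i=1..n. \<Sum>j=1..n. prob (E i \<inter> E j) - prob (E i) * prob (E j))"
      using E by (intro sum.cong refl centered_indicator_products) auto
    also have "\<dots> \<le> (\<Sum>i=1..n. \<eta> * real n + 2 * real K)"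
    proof (rule sum_mono)
      fix i assume i: "i \<in> {1..n}"
      have "(\<Sum>j=1..n. prob (E i \<inter> E j) - prob (E i) * prob (E j)) \<le>
          (\<Sum>j=1..n. \<eta> + of_bool (\<bar>real i - real j\<bar> < real K))"
      proof (rule sum_mono)
        fix j assume "j \<in> {1..n}"
        then have "real K \<le> \<bar>real i - real j\<bar> \<Longrightarrow> prob (E i \<inter> E j) - prob (E i) * prob (E j) \<le> \<eta>"
          using i by (intro K) auto
        moreover have "prob (E i \<inter> E j) - prob (E i) * prob (E j) \<le> 1"
          using prob_le_1[of "E i \<inter> E j"] mult_nonneg_nonneg[OF measure_nonneg measure_nonneg, of M "E i" M "E j"]
          by linarith
        ultimately show "prob (E i \<inter> E j) - prob (E i) * prob (E j) \<le>
            \<eta> + of_bool (\<bar>real i - real j\<bar> < real K)"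
          using \<eta> by auto
      qed
      also have "\<dots> = \<eta> * real n + real (card ({1..n} \<inter> {j. \<bar>real i - real j\<bar> < real K}))"
        by (simp add: sum.distrib sum_of_bool_eq)
      also have "card ({1..n} \<inter> {j. \<bar>real i - real j\<bar> < real K}) \<le> card {i + 1 - K..<i + K}"
        by (intro card_mono) auto
      also have "card {i + 1 - K..<i + K} \<le> 2 * K" by auto
      finally show "(\<Sum>j=1..n. prob (E i \<inter> E j) - prob (E i) * prob (E j)) \<le> \<eta> * real n + 2 * real K"
        by simp
    qed
    also have "\<dots> = \<eta> * (real n)\<^sup>2 + 2 * real K * real n"
      by (simp add: algebra_simps power2_eq_square)
    finally show ?thesis .
  qed
  have chebyshev: "prob {\<omega> \<in> space M. \<bar>1 / real n * S n \<omega>\<bar> > \<epsilon>} \<le> expectation (\<lambda>\<omega>. (S n \<omega>)\<^sup>2) / (\<epsilon> * real n)\<^sup>2"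
    if n: "n > 0" for n
  proof -
    have "prob {\<omega> \<in> space M. \<bar>1 / real n * S n \<omega>\<bar> > \<epsilon>} \<le> prob {\<omega> \<in> space M. \<epsilon> * real n \<le> \<bar>S n \<omega>\<bar>}"
      using n by (intro finite_measure_mono) (auto simp: abs_mult field_simps)
    also have "\<dots> \<le> expectation (\<lambda>\<omega>. (S n \<omega>)\<^sup>2) / (\<epsilon> * real n)\<^sup>2"
      using n \<epsilon> int by (intro second_moment_method) auto
    finally show ?thesis .
  qed
  show ?thesis
    unfolding S_def[symmetric]
  proof (rule LIMSEQ_I)
    fix \<delta> :: real assume \<delta>: "\<delta> > 0"
    \<comment> \<open>For large \<open>n\<close> the near-diagonal part \<open>2 K n\<close> is below \<open>\<eta> n\<^sup>2\<close>, so the second moment is below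
      \<open>2 \<eta> n\<^sup>2\<close>, and this choice makes the Chebyshev bound equal to \<open>\<delta>\<close>.\<close>
    define \<eta> where "\<eta> = \<delta> * \<epsilon>\<^sup>2 / 2"
    have \<eta>: "\<eta> > 0" using \<delta> \<epsilon> by (simp add: \<eta>_def)
    obtain K where K: "\<And>i j. i \<ge> 1 \<Longrightarrow> j \<ge> 1 \<Longrightarrow> real K \<le> \<bar>real i - real j\<bar> \<Longrightarrow>
       prob (E i \<inter> E j) - prob (E i) * prob (E j) \<le> \<eta>"
      using decorr[OF \<eta>] by blast
    obtain N :: nat where N: "real N > 2 * real K / \<eta>" using reals_Archimedean2 by blast
    show "\<exists>no. \<forall>n\<ge>no. norm (prob {\<omega> \<in> space M. \<bar>1 / real n * S n \<omega>\<bar> > \<epsilon>} - 0) < \<delta>"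
    proof (intro exI allI impI)
      fix n assume n: "n \<ge> Suc N"
      then have "2 * real K / \<eta> < real n" using N by linarith
      then have "2 * real K < \<eta> * real n" using \<eta> by (simp add: field_simps)
      then have "2 * real K * real n < \<eta> * (real n)\<^sup>2" using n by (simp add: power2_eq_square)
      moreover have "expectation (\<lambda>\<omega>. (S n \<omega>)\<^sup>2) \<le> \<eta> * (real n)\<^sup>2 + 2 * real K * real n"
        using \<eta> K by (rule second_moment)
      ultimately have "expectation (\<lambda>\<omega>. (S n \<omega>)\<^sup>2) < 2 * \<eta> * (real n)\<^sup>2" by linarith
      also have "\<dots> = \<delta> * (\<epsilon> * real n)\<^sup>2" by (simp add: \<eta>_def power_mult_distrib)
      finally have "expectation (\<lambda>\<omega>. (S n \<omega>)\<^sup>2) / (\<epsilon> * real n)\<^sup>2 < \<delta>"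
        using \<epsilon> n by (simp add: pos_divide_less_eq)
      then show "norm (prob {\<omega> \<in> space M. \<bar>1 / real n * S n \<omega>\<bar> > \<epsilon>} - 0) < \<delta>"
        using chebyshev[of n] n by simp
    qed
  qed
qed

section \<open>The probability integral transform\<close>

lemma \<Phi>_strict_mono: "strict_mono \<Phi>"
proof (rule strict_monoI)
  fix x y :: real assume "x < y"
  have "emeasure std_normal_distribution {x<..y} \<noteq> 0"
  proof
    assume "emeasure std_normal_distribution {x<..y} = 0"
    moreover have "std_normal_density z \<noteq> 0" for z
      using normal_density_pos[of 1 0 z] by simp
    ultimately have "AE z in lborel. z \<notin> {x<..y}"
      by (simp add: emeasure_density nn_integral_0_iff_AE indicator_def)
    then have "emeasure lborel {x<..y} = 0"
      by (subst (asm) AE_iff_measurable[of "{x<..y}"]) auto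
    then show False using \<open>x < y\<close> by simp
  qed
  then have "measure std_normal_distribution {x<..y} \<noteq> 0"
    by (simp add: std_normal.emeasure_eq_measure)
  then have "0 < measure std_normal_distribution {x<..y}" 
    by (metis measure_nonneg order_le_less)
  then show "\<Phi> x < \<Phi> y"
    using std_normal.cdf_diff_eq[OF \<open>x < y\<close>] by (simp add: \<Phi>_def)
qed

lemma isCont_\<Phi>: "isCont \<Phi> x"
  unfolding \<Phi>_def std_normal.isCont_cdf
  by (simp add: measure_def emeasure_std_normal_singleton)

lemma \<Phi>_pos: "0 < \<Phi> x"
proof -
  have "0 \<le> \<Phi> (x - 1)" by (simp add: \<Phi>_def cdf_def)
  also have "\<dots> < \<Phi> x" using \<Phi>_strict_mono by (simp add: strict_mono_def)
  finally show ?thesis .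
qed

lemma \<Phi>_le_1: "\<Phi> x \<le> 1"
  by (simp add: \<Phi>_def cdf_def)

text \<open>
  On \<open>(0, 1)\<close> the event \<open>\<Phi> Y \<le> t\<close> is a half-line event \<open>Y \<le> a\<close>, and its probability is \<open>\<Phi> a = t\<close>; this
  is both the reduction to half-lines and the uniformity of \<open>\<Phi> Y\<close>.
\<close>

lemma \<Phi>_quantile:
  assumes "0 < t" "t < 1"
  obtains a where "\<Phi> a = t" "\<And>y. \<Phi> y \<le> t \<longleftrightarrow> y \<le> a"
proof -
  have "eventually (\<lambda>x. \<Phi> x < t) at_bot" "eventually (\<lambda>x. t < \<Phi> x) at_top"
    using order_tendstoD(2)[OF std_normal.cdf_lim_at_bot \<open>0 < t\<close>]
      order_tendstoD(1)[OF std_normal.cdf_lim_at_top_prob \<open>t < 1\<close>] by (simp_all add: \<Phi>_def)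
  then obtain l u where lu: "\<Phi> l < t" "t < \<Phi> u"
    unfolding eventually_at_bot_linorder eventually_at_top_linorder by blast
  then have "l < u" using \<Phi>_strict_mono strict_mono_less by fastforce
  then obtain a where "\<Phi> a = t"
    using IVT[of \<Phi> l t u] lu isCont_\<Phi> by auto
  moreover then have "\<Phi> y \<le> t \<longleftrightarrow> y \<le> a" for y
    using strict_mono_less_eq[OF \<Phi>_strict_mono, of y a] by simp
  ultimately show ?thesis by (rule that)
qed

section \<open>From pointwise to uniform deviations\<close>

text \<open>
  The Glivenko--Cantelli argument against the uniform distribution function: between neighbouring
  grid points both functions are monotone and the uniform one grows by only \<open>1 / m\<close>. The grid points
  \<open>0\<close> and \<open>1\<close> have deviation \<open>0\<close> by the boundary values.
\<close>

lemma cdf_deviation_le_grid_deviation: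
  fixes F :: "real \<Rightarrow> real"
  assumes "mono F" and F0: "\<And>t. t \<le> 0 \<Longrightarrow> F t = 0" and F1: "\<And>t. t \<ge> 1 \<Longrightarrow> F t = 1"
    and m: "m > 0" and \<eta>: "\<eta> \<ge> 0"
    and grid: "\<And>k. k \<in> {1..<m} \<Longrightarrow> \<bar>F (real k / real m) - real k / real m\<bar> \<le> \<eta>"
  shows "\<bar>F t - max 0 (min 1 t)\<bar> \<le> \<eta> + 1 / real m"
proof -
  consider "t \<le> 0" | "t \<ge> 1" | "0 < t" "t < 1" by linarith
  then show ?thesis
  proof cases
    case 3
    have grid': "\<bar>F (real k / real m) - real k / real m\<bar> \<le> \<eta>" if "k \<le> m" for k
      using that grid[of k] F0[of 0] F1[of 1] m \<eta> by (cases "k = 0"; cases "k = m") auto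
    define k where "k = nat \<lfloor>real m * t\<rfloor>"
    have k: "real k \<le> real m * t" "real m * t < real k + 1"
      using 3 by (simp_all add: k_def)
    have "real m * t < real m" using 3 m by simp
    with k have "k < m" by linarith
    have t: "real k / real m \<le> t" "t \<le> real (Suc k) / real m"
      using k m by (simp_all add: field_simps)
    have "F (real k / real m) \<le> F t" "F t \<le> F (real (Suc k) / real m)"
      using t by (auto intro: monoD[OF \<open>mono F\<close>])
    moreover have "real (Suc k) / real m = real k / real m + 1 / real m"
      by (simp add: add_divide_distrib)
    ultimately show ?thesis
      using grid'[of k] grid'[of "Suc k"] \<open>k < m\<close> t 3 by auto
  qed (use \<eta> F0 F1 in auto)
qed

text \<open>
  Right continuity makes the supremum over the reals equal to the supremum over the rationals, which
  is a supremum of countably many measurable functions. It is needed because convergence in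
  probability demands that the supremum be a random variable.
\<close>

lemma borel_measurable_SUP_right_continuous:
  fixes D :: "real \<Rightarrow> 'a \<Rightarrow> real"
  assumes meas: "\<And>t. D t \<in> borel_measurable M"
    and bdd: "\<And>\<omega>. bdd_above (range (\<lambda>t. D t \<omega>))"
    and right_cont: "\<And>t \<omega>. ((\<lambda>s. D s \<omega>) \<longlongrightarrow> D t \<omega>) (at_right t)"
  shows "(\<lambda>\<omega>. SUP t. D t \<omega>) \<in> borel_measurable M"
proof -
  have bddQ: "bdd_above ((\<lambda>t. D t \<omega>) ` \<rat>)" for \<omega>
    using bdd by (rule bdd_above_mono) auto
  have "(SUP t. D t \<omega>) = (SUP t\<in>\<rat>. D t \<omega>)" for \<omega>
  proof (rule antisym)
    show "(SUP t. D t \<omega>) \<le> (SUP t\<in>\<rat>. D t \<omega>)"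
    proof (rule cSUP_least)
      fix t
      show "D t \<omega> \<le> (SUP t\<in>\<rat>. D t \<omega>)"
      proof (rule ccontr)
        assume "\<not> ?thesis"
        then have "eventually (\<lambda>s. (SUP t\<in>\<rat>. D t \<omega>) < D s \<omega>) (at_right t)"
          by (intro order_tendstoD(1)[OF right_cont]) simp
        then obtain b where b: "b > t" "\<And>s. t < s \<Longrightarrow> s < b \<Longrightarrow> (SUP t\<in>\<rat>. D t \<omega>) < D s \<omega>"
          unfolding eventually_at_right_field by blast
        obtain s where "s \<in> \<rat>" "t < s" "s < b"
          using Rats_dense_in_real[OF \<open>b > t\<close>] by blast
        then show False
          using b(2)[of s] cSUP_upper[OF \<open>s \<in> \<rat>\<close> bddQ[of \<omega>]] by simp
      qed
    qed simp
    show "(SUP t\<in>\<rat>. D t \<omega>) \<le> (SUP t. D t \<omega>)"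
      using bdd by (intro cSUP_subset_mono) (auto intro: Rats_0)
  qed
  moreover have "(\<lambda>\<omega>. SUP t\<in>\<rat>. D t \<omega>) \<in> borel_measurable M"
    using meas bddQ countable_rat by (intro borel_measurable_cSUP) auto
  ultimately show ?thesis by simp
qed

lemma empirical_distribution_bounds:
  "0 \<le> empirical_distribution X n t \<omega>" "empirical_distribution X n t \<omega> \<le> 1"
proof -
  show "0 \<le> empirical_distribution X n t \<omega>"
    by (simp add: empirical_distribution_def sum_nonneg)
  have "(\<Sum>i=1..n. of_bool (\<Phi> (X i \<omega>) \<le> t) :: real) \<le> (\<Sum>i=1..n. 1)"
    by (intro sum_mono) simp
  then show "empirical_distribution X n t \<omega> \<le> 1"
    by (cases "n = 0") (simp_all add: empirical_distribution_def field_simps)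
qed

lemma mono_empirical_distribution: "mono (\<lambda>t. empirical_distribution X n t \<omega>)"
  unfolding empirical_distribution_def
  by (intro monoI mult_left_mono sum_mono) auto

lemma empirical_distribution_no_sample: "empirical_distribution X 0 t = (\<lambda>_. 0)"
  by (simp add: empirical_distribution_def fun_eq_iff)

lemma empirical_distribution_eq_0:
  assumes "t \<le> 0" shows "empirical_distribution X n t \<omega> = 0"
proof -
  have "\<not> \<Phi> (X i \<omega>) \<le> t" for i using \<Phi>_pos[of "X i \<omega>"] assms by simp
  then show ?thesis by (simp add: empirical_distribution_def)
qed

lemma empirical_distribution_eq_1:
  assumes "n > 0" "t \<ge> 1" shows "empirical_distribution X n t \<omega> = 1"
proof -
  have "\<Phi> (X i \<omega>) \<le> t" for i using \<Phi>_le_1 assms(2) by (rule order_trans)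
  then show ?thesis using assms(1) by (simp add: empirical_distribution_def)
qed

lemma empirical_distribution_right_continuous:
  "((\<lambda>s. empirical_distribution X n s \<omega>) \<longlongrightarrow> empirical_distribution X n t \<omega>) (at_right t)"
proof -
  have "((\<lambda>s. of_bool (v \<le> s) :: real) \<longlongrightarrow> of_bool (v \<le> t)) (at_right t)" for v
  proof (rule tendsto_eventually, cases "v \<le> t")
    case True
    then show "eventually (\<lambda>s. of_bool (v \<le> s) = (of_bool (v \<le> t) :: real)) (at_right t)"
      using eventually_at_right_less[of t] by (auto elim!: eventually_mono)
  next
    case False
    then show "eventually (\<lambda>s. of_bool (v \<le> s) = (of_bool (v \<le> t) :: real)) (at_right t)"
      using eventually_at_right_real[of t v] by (auto elim!: eventually_mono)
  qed
  then show ?thesis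
    unfolding empirical_distribution_def by (intro tendsto_intros)
qed

lemma borel_measurable_\<Phi> [measurable]: "\<Phi> \<in> borel_measurable borel"
  using isCont_\<Phi> by (intro borel_measurable_continuous_onI) (simp add: continuous_at_imp_continuous_on)

lemma borel_measurable_empirical_distribution:
  assumes "\<And>i. i \<ge> 1 \<Longrightarrow> X i \<in> borel_measurable M"
  shows "empirical_distribution X n t \<in> borel_measurable M"
proof -
  have "(\<lambda>\<omega>. of_bool (\<Phi> (X i \<omega>) \<le> t) :: real) \<in> borel_measurable M" if "i \<in> {1..n}" for i
  proof -
    have [measurable]: "X i \<in> borel_measurable M" using assms that by simp
    show ?thesis by measurable
  qed
  then show ?thesis
    unfolding empirical_distribution_def[abs_def]
    by (intro borel_measurable_times borel_measurable_sum) auto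
qed

lemma (in prob_space) prob_\<Phi>_le:
  assumes "distributed M lborel Y std_normal_density" "0 < t" "t < 1"
  shows "prob {\<omega> \<in> space M. \<Phi> (Y \<omega>) \<le> t} = t"
proof -
  obtain a where "\<Phi> a = t" "\<And>y. \<Phi> y \<le> t \<longleftrightarrow> y \<le> a"
    using \<Phi>_quantile assms(2,3) by blast
  then show ?thesis
    using distributed_std_normal_le[OF prob_space_axioms assms(1), of a] by simp
qed

lemma (in prob_space) expectation_empirical_distribution:
  assumes X: "\<And>i. i \<ge> 1 \<Longrightarrow> distributed M lborel (X i) std_normal_density" and n: "n > 0"
  shows "expectation (empirical_distribution X n t) = max 0 (min 1 t)"
proof -
  consider "t \<le> 0" | "t \<ge> 1" | "0 < t" "t < 1" by linarith
  then show ?thesis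
  proof cases
    case 3
    have rv: "X i \<in> borel_measurable M" if "i \<ge> 1" for i
      using distributed_measurable[OF X[OF that]] by simp
    have summand: "integrable M (\<lambda>\<omega>. of_bool (\<Phi> (X i \<omega>) \<le> t) :: real) \<and>
        expectation (\<lambda>\<omega>. of_bool (\<Phi> (X i \<omega>) \<le> t)) = t" if i: "i \<in> {1..n}" for i
    proof -
      have [measurable]: "X i \<in> borel_measurable M" using rv i by simp
      have A: "{\<omega> \<in> space M. \<Phi> (X i \<omega>) \<le> t} \<in> events" by measurable
      have "integrable M (indicat_real {\<omega> \<in> space M. \<Phi> (X i \<omega>) \<le> t})"
        "expectation (indicat_real {\<omega> \<in> space M. \<Phi> (X i \<omega>) \<le> t}) = t"
        using A prob_\<Phi>_le[OF X 3] i by (simp_all add: less_top[symmetric])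
      moreover have "of_bool (\<Phi> (X i \<omega>) \<le> t) = indicat_real {\<omega> \<in> space M. \<Phi> (X i \<omega>) \<le> t} \<omega>"
        if "\<omega> \<in> space M" for \<omega> using that by (simp add: indicator_def)
      ultimately show ?thesis
        by (simp cong: Bochner_Integration.integrable_cong Bochner_Integration.integral_cong)
    qed
    have "expectation (empirical_distribution X n t) =
        1 / real n * expectation (\<lambda>\<omega>. \<Sum>i=1..n. of_bool (\<Phi> (X i \<omega>) \<le> t) :: real)"
      unfolding empirical_distribution_def[abs_def] by (rule integral_mult_right_zero)
    also have "expectation (\<lambda>\<omega>. \<Sum>i=1..n. of_bool (\<Phi> (X i \<omega>) \<le> t) :: real) =
        (\<Sum>i=1..n. expectation (\<lambda>\<omega>. of_bool (\<Phi> (X i \<omega>) \<le> t) :: real))"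
      by (rule Bochner_Integration.integral_sum) (rule summand[THEN conjunct1])
    also have "(\<Sum>i=1..n. expectation (\<lambda>\<omega>. of_bool (\<Phi> (X i \<omega>) \<le> t) :: real)) = (\<Sum>i=1..n. t)"
      by (rule sum.cong[OF refl]) (rule summand[THEN conjunct2])
    finally show ?thesis using n 3 by simp
  next
    case 1
    then have "empirical_distribution X n t = (\<lambda>_. 0)" by (simp add: empirical_distribution_eq_0 fun_eq_iff)
    then show ?thesis using 1 by simp
  next
    case 2
    then have "empirical_distribution X n t = (\<lambda>_. 1)" using n by (simp add: empirical_distribution_eq_1 fun_eq_iff)
    then show ?thesis using 2 by (simp add: prob_space)
  qed
qed

section \<open>Convergence of the empirical process\<close>

text \<open>
  For fixed \<open>t\<close> the empirical distribution is the frequency of the events \<open>X i \<le> a\<close>. Since \<open>r\<close> vanishes at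
  infinity, distant indices have small correlation, so these events are asymptotically uncorrelated
  and the weak law applies.
\<close>

lemma (in prob_space) empirical_distribution_pointwise_law:
  fixes X :: "nat \<Rightarrow> 'a \<Rightarrow> real" and r :: "real \<Rightarrow> real"
  assumes sgp: "standardized_gaussian_process M {1..} X"
    and r: "(r \<longlongrightarrow> 0) at_top"
    and cov: "\<And>i j. i \<ge> 1 \<Longrightarrow> j \<ge> 1 \<Longrightarrow> \<bar>expectation (\<lambda>\<omega>. X i \<omega> * X j \<omega>)\<bar> \<le> r \<bar>real i - real j\<bar>"
    and t: "0 < t" "t < 1" and \<epsilon>: "\<epsilon> > 0"
  shows "(\<lambda>n. prob {\<omega> \<in> space M. \<bar>empirical_distribution X n t \<omega> - t\<bar> > \<epsilon>}) \<longlonglongrightarrow> 0"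
proof -
  have X: "X i \<in> borel_measurable M" "distributed M lborel (X i) std_normal_density" if "i \<ge> 1" for i
    using sgp that unfolding standardized_gaussian_process_def gaussian_process_def by auto
  obtain a where a: "\<Phi> a = t" "\<And>y. \<Phi> y \<le> t \<longleftrightarrow> y \<le> a"
    using \<Phi>_quantile t by blast
  define E where "E i = {\<omega> \<in> space M. X i \<omega> \<le> a}" for i
  have E: "E i \<in> events" "prob (E i) = t" if "i \<ge> 1" for i
  proof -
    have [measurable]: "X i \<in> borel_measurable M" using X that by simp
    show "E i \<in> events" unfolding E_def by measurable
    show "prob (E i) = t"
      unfolding E_def using distributed_std_normal_le[OF prob_space_axioms X(2)[OF that]] a by simp
  qed
  have lim: "(\<lambda>n. prob {\<omega> \<in> space M. \<bar>1 / real n * (\<Sum>i=1..n. indicat_real (E i) \<omega> - prob (E i))\<bar> > \<epsilon>}) \<longlonglongrightarrow> 0"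
  proof (rule weak_law_decorrelated_events[OF E(1) _ \<epsilon>])
    fix \<eta> :: real assume "\<eta> > 0"
    then obtain \<delta> where \<delta>: "\<delta> > 0" and decorr: "\<And>i j. i \<in> {1..} \<Longrightarrow> j \<in> {1..} \<Longrightarrow> i \<noteq> j \<Longrightarrow>
        \<bar>expectation (\<lambda>\<omega>. X i \<omega> * X j \<omega>)\<bar> < \<delta> \<Longrightarrow> \<bar>prob (E i \<inter> E j) - prob (E i) * prob (E j)\<bar> < \<eta>"
      unfolding E_def using gaussian_half_lines_decorrelate[OF prob_space_axioms sgp, of \<eta> a] by blast
    obtain B where B: "\<And>x. x \<ge> B \<Longrightarrow> r x < \<delta>"
      using order_tendstoD(2)[OF r \<delta>] unfolding eventually_at_top_linorder by blast
    show "\<exists>K::nat. \<forall>i\<ge>1. \<forall>j\<ge>1. real K \<le> \<bar>real i - real j\<bar> \<longrightarrow>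
       prob (E i \<inter> E j) - prob (E i) * prob (E j) \<le> \<eta>"
    \<comment> \<open>The successor forces the gap to be at least \<open>1\<close>, hence \<open>i \<noteq> j\<close>, even when \<open>B \<le> 0\<close>.\<close>
    proof (intro exI allI impI)
      fix i j :: nat assume ij: "i \<ge> 1" "j \<ge> 1" and K: "real (Suc (nat \<lceil>B\<rceil>)) \<le> \<bar>real i - real j\<bar>"
      then have "B \<le> \<bar>real i - real j\<bar>" "i \<noteq> j" by (linarith, auto)
      then show "prob (E i \<inter> E j) - prob (E i) * prob (E j) \<le> \<eta>"
        using decorr[of i j] ij cov[OF ij] B[of "\<bar>real i - real j\<bar>"] by force
    qed
  qed
  have centered: "1 / real n * (\<Sum>i=1..n. indicat_real (E i) \<omega> - prob (E i)) = empirical_distribution X n t \<omega> - t"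
    if "n > 0" "\<omega> \<in> space M" for n \<omega>
  proof -
    have "(\<Sum>i=1..n. indicat_real (E i) \<omega> - prob (E i)) = (\<Sum>i=1..n. of_bool (\<Phi> (X i \<omega>) \<le> t) - t)"
      using that E a by (intro sum.cong) (auto simp: E_def)
    then show ?thesis using that(1) by (simp add: empirical_distribution_def sum_subtractf right_diff_distrib)
  qed
  have "eventually (\<lambda>n. prob {\<omega> \<in> space M. \<bar>1 / real n * (\<Sum>i=1..n. indicat_real (E i) \<omega> - prob (E i))\<bar> > \<epsilon>}
      = prob {\<omega> \<in> space M. \<bar>empirical_distribution X n t \<omega> - t\<bar> > \<epsilon>}) sequentially"
    by (intro eventually_sequentiallyI[of 1] arg_cong[where f = prob] Collect_cong conj_cong refl)
       (simp only: centered)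
  with lim show ?thesis by (rule Lim_transform_eventually)
qed

theorem corollary2:
  fixes M :: "'a measure" and X :: "nat \<Rightarrow> 'a \<Rightarrow> real" and r :: "real \<Rightarrow> real"
  assumes "prob_space M"
    and "standardized_gaussian_process M {1..} X"
    and "(r \<longlongrightarrow> 0) at_top"
    and "\<And>i j. i \<ge> 1 \<Longrightarrow> j \<ge> 1 \<Longrightarrow>
           \<bar>\<integral>\<omega>. X i \<omega> * X j \<omega> \<partial>M\<bar> \<le> r \<bar>real i - real j\<bar>"
  shows "converges_in_probability M
           (\<lambda>n \<omega>. SUP t. \<bar>empirical_distribution X n t \<omega>
                           - (\<integral>\<omega>'. empirical_distribution X n t \<omega>' \<partial>M)\<bar>)
           (\<lambda>_. 0)"
proof -
  interpret prob_space M by fact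
  let ?F = "empirical_distribution X"
  define Y where "Y n \<omega> = (SUP t. \<bar>?F n t \<omega> - expectation (?F n t)\<bar>)" for n \<omega>
  have X: "X i \<in> borel_measurable M" "distributed M lborel (X i) std_normal_density" if "i \<ge> 1" for i
    using assms(2) that unfolding standardized_gaussian_process_def gaussian_process_def by auto
  have F_meas [measurable]: "?F n t \<in> borel_measurable M" for n t
    using X(1) by (rule borel_measurable_empirical_distribution)
  have mean: "expectation (?F n t) = max 0 (min 1 t)" if "n > 0" for n t
    using X(2) that by (rule expectation_empirical_distribution)
  have mean_cont: "((\<lambda>s. expectation (?F n s)) \<longlongrightarrow> expectation (?F n t)) (at_right t)" for n t
  proof (cases "n = 0")
    case True
    then show ?thesis by (simp add: empirical_distribution_no_sample)
  next
    case False
    then show ?thesis by (simp add: mean) (intro tendsto_intros)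
  qed
  have mean_bounds: "0 \<le> expectation (?F n t)" "expectation (?F n t) \<le> 1" for n t
    by (cases "n = 0"; simp add: mean empirical_distribution_no_sample)+
  have "Y n \<in> borel_measurable M" for n
    unfolding Y_def
  proof (rule borel_measurable_SUP_right_continuous)
    show "(\<lambda>\<omega>. \<bar>?F n t \<omega> - expectation (?F n t)\<bar>) \<in> borel_measurable M" for t
      by measurable
    show "((\<lambda>s. \<bar>?F n s \<omega> - expectation (?F n s)\<bar>) \<longlongrightarrow> \<bar>?F n t \<omega> - expectation (?F n t)\<bar>) (at_right t)" for t \<omega>
      by (intro tendsto_intros mean_cont empirical_distribution_right_continuous)
    have "\<bar>?F n t \<omega> - expectation (?F n t)\<bar> \<le> 1" for t \<omega>
      using empirical_distribution_bounds[of X n t \<omega>] mean_bounds[of n t] by linarith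
    then show "bdd_above (range (\<lambda>t. \<bar>?F n t \<omega> - expectation (?F n t)\<bar>))" for \<omega>
      by (intro bdd_aboveI2)
  qed
  moreover have "(\<lambda>n. prob {\<omega> \<in> space M. \<bar>Y n \<omega> - 0\<bar> > \<epsilon>}) \<longlonglongrightarrow> 0" if \<epsilon>: "\<epsilon> > 0" for \<epsilon>
  proof -
    \<comment> \<open>A grid of mesh at most \<open>\<epsilon> / 2\<close>: a uniform deviation above \<open>\<epsilon>\<close> forces a deviation above
      \<open>\<epsilon> / 2\<close> at one of finitely many grid points.\<close>
    obtain m0 :: nat where m0: "real m0 > 2 / \<epsilon>" using reals_Archimedean2 by blast
    define m where "m = Suc m0"
    have "2 / \<epsilon> < real m" using m0 by (simp add: m_def)
    then have m: "m > 0" "1 / real m \<le> \<epsilon> / 2" using \<epsilon> by (simp_all add: m_def field_simps)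
    have \<epsilon>2: "\<epsilon> / 2 \<ge> 0" using \<epsilon> by simp
    let ?A = "\<lambda>n k. {\<omega> \<in> space M. \<bar>?F n (real k / real m) \<omega> - real k / real m\<bar> > \<epsilon> / 2}"
    have A: "?A n k \<in> events" for n k by measurable
    have incl: "{\<omega> \<in> space M. \<bar>Y n \<omega> - 0\<bar> > \<epsilon>} \<subseteq> (\<Union>k\<in>{1..<m}. ?A n k)" if n: "n > 0" for n
    proof
      fix \<omega> assume "\<omega> \<in> {\<omega> \<in> space M. \<bar>Y n \<omega> - 0\<bar> > \<epsilon>}"
      then have \<omega>: "\<omega> \<in> space M" "\<bar>Y n \<omega>\<bar> > \<epsilon>" by auto
      show "\<omega> \<in> (\<Union>k\<in>{1..<m}. ?A n k)"
      proof (rule ccontr)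
        assume "\<omega> \<notin> (\<Union>k\<in>{1..<m}. ?A n k)"
        then have grid: "\<bar>?F n (real k / real m) \<omega> - real k / real m\<bar> \<le> \<epsilon> / 2" if "k \<in> {1..<m}" for k
          using that \<omega>(1) by (auto simp: not_less)
        have dev: "\<bar>?F n t \<omega> - expectation (?F n t)\<bar> \<le> \<epsilon>" for t
        proof -
          have "\<bar>?F n t \<omega> - max 0 (min 1 t)\<bar> \<le> \<epsilon> / 2 + 1 / real m"
            using mono_empirical_distribution empirical_distribution_eq_0
              empirical_distribution_eq_1[OF n] m(1) \<epsilon>2 grid
            by (rule cdf_deviation_le_grid_deviation)
          then show ?thesis using m(2) by (simp add: mean[OF n])
        qed
        have "Y n \<omega> \<le> \<epsilon>"
          unfolding Y_def by (rule cSUP_least) (use dev in auto)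
        moreover have "0 \<le> Y n \<omega>"
          unfolding Y_def by (rule cSUP_upper2[of _ _ 0]) (use dev in \<open>auto intro!: bdd_aboveI2\<close>)
        ultimately show False using \<omega>(2) by simp
      qed
    qed
    have "(\<lambda>n. \<Sum>k\<in>{1..<m}. prob (?A n k)) \<longlonglongrightarrow> 0"
    proof (rule tendsto_null_sum)
      fix k assume "k \<in> {1..<m}"
      then show "(\<lambda>n. prob (?A n k)) \<longlonglongrightarrow> 0"
        using \<epsilon> by (intro empirical_distribution_pointwise_law[OF assms(2-4)]) auto
    qed
    moreover have "eventually (\<lambda>n. norm (prob {\<omega> \<in> space M. \<bar>Y n \<omega> - 0\<bar> > \<epsilon>}) \<le> (\<Sum>k\<in>{1..<m}. prob (?A n k))) sequentially"
    proof (rule eventually_sequentiallyI[of 1])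
      fix n :: nat assume "n \<ge> 1"
      then have "prob {\<omega> \<in> space M. \<bar>Y n \<omega> - 0\<bar> > \<epsilon>} \<le> prob (\<Union>k\<in>{1..<m}. ?A n k)"
        using A by (intro finite_measure_mono incl) auto
      also have "\<dots> \<le> (\<Sum>k\<in>{1..<m}. prob (?A n k))"
        using A by (intro finite_measure_subadditive_finite) auto
      finally show "norm (prob {\<omega> \<in> space M. \<bar>Y n \<omega> - 0\<bar> > \<epsilon>}) \<le> (\<Sum>k\<in>{1..<m}. prob (?A n k))"
        by simp
    qed
    ultimately show ?thesis by (rule Lim_null_comparison[rotated])
  qed
  ultimately show ?thesis
    unfolding converges_in_probability_def Y_def by simp
qed

end
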